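(* Let $\varphi$ be a quantifier-free $\mathcal{T}$-formula and $\boldsymbol{\alpha}$ a finite set of atoms containing all atoms of $\varphi$. Let $\{C_1,\ldots,C_K\}$ be a set of $\mathcal{T}$-lemmas on $\boldsymbol{\alpha}$ which rules out $P_{\boldsymbol{\alpha}}(\neg\varphi)$, and let $\mathrm{Text}(\varphi)=\varphi\vee\neg\big(\bigwedge_{l=1}^K C_l\big)$. Then (i) $\mathrm{Text}(\varphi)\equiv_{\mathcal{T}}\varphi$; (ii) $\varphi\models_p\mathrm{Text}(\varphi)$; (iii) $\mathrm{Text}(\varphi)$ is $\mathcal{T}$-extended with respect to $\boldsymbol{\alpha}$.
   Context: $\mathcal{T}$-formulas are quantifier-free formulas built by Boolean connectives from $\mathcal{T}$-atoms and Boolean atoms. The Boolean abstraction maps each atom bijectively to a Boolean variable; $\varphi\models_p\psi$ means the Boolean abstraction of $\varphi$ entails that of $\psi$ propositionally. $\equiv_{\mathcal{T}}$ is equivalence modulo $\mathcal{T}$. A $\mathcal{T}$-lemma is a $\mathcal{T}$-valid clause. A total truth assignment on $\boldsymbol{\alpha}$ is a conjunction containing, for each $a\in\boldsymbol{\alpha}$, exactly one of $a,\neg a$. $P_{\boldsymbol{\alpha}}(\psi)$ is the set of $\mathcal{T}$-unsatisfiable total truth assignments $\rho$ on $\boldsymbol{\alpha}$ with $\rho\models_p\psi$. A set of $\mathcal{T}$-lemmas $\{C_1,\dots,C_K\}$ rules out a set $\{\rho_1,\dots,\rho_M\}$ of $\mathcal{T}$-unsatisfiable total truth assignments iff for every $\rho_j$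 there is some $C_l$ with $\rho_j\models_p\neg C_l$. A formula $\psi$ is $\mathcal{T}$-extended with respect to $\boldsymbol{\alpha}$ iff $P_{\boldsymbol{\alpha}}(\neg\psi)=\emptyset$. *)

theory Defs
  imports Main
begin

datatype (atoms: 'a) form =
    Top
  | Bot
  | Atom 'a
  | Neg "'a form"
  | And "'a form" "'a form"
  | Or "'a form" "'a form"
  | Imp "'a form" "'a form"
  | Iff "'a form" "'a form"

primrec eval :: "('a \<Rightarrow> bool) \<Rightarrow> 'a form \<Rightarrow> bool" where
  "eval v Top = True"
| "eval v Bot = False"
| "eval v (Atom a) = v a"
| "eval v (Neg p) = (\<not> eval v p)"
| "eval v (And p q) = (eval v p \<and> eval v q)"
| "eval v (Or p q) = (eval v p \<or> eval v q)"
| "eval v (Imp p q) = (eval v p \<longrightarrow> eval v q)"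
| "eval v (Iff p q) = (eval v p \<longleftrightarrow> eval v q)"

fun big_and :: "'a form list \<Rightarrow> 'a form" where
  "big_and [] = Top"
| "big_and [p] = p"
| "big_and (p # q # ps) = And p (big_and (q # ps))"

fun big_or :: "'a form list \<Rightarrow> 'a form" where
  "big_or [] = Bot"
| "big_or [p] = p"
| "big_or (p # q # ps) = Or p (big_or (q # ps))"

definition is_literal :: "'a form \<Rightarrow> bool" where
  "is_literal l \<longleftrightarrow> (\<exists>a. l = Atom a \<or> l = Neg (Atom a))"

definition is_clause :: "'a form \<Rightarrow> bool" where
  "is_clause C \<longleftrightarrow> (\<exists>ls. (\<forall>l\<in>set ls. is_literal l) \<and> C = big_or ls)"

text \<open>Conjunctions are syntactic objects here, so a truth assignment occurs once for
  every order in which its literals can be listed.\<close>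

definition total_assignment :: "'a set \<Rightarrow> 'a form \<Rightarrow> bool" where
  "total_assignment \<alpha> \<rho> \<longleftrightarrow>
    (\<exists>ls. distinct ls \<and>
          (\<forall>l\<in>set ls. \<exists>a\<in>\<alpha>. l = Atom a \<or> l = Neg (Atom a)) \<and>
          (\<forall>a\<in>\<alpha>. (Atom a \<in> set ls) \<noteq> (Neg (Atom a) \<in> set ls)) \<and>
          \<rho> = big_and ls)"

datatype 'a bool_var = Bool_Var 'a

definition bool_abs :: "'a form \<Rightarrow> 'a bool_var form" where
  "bool_abs = map_form Bool_Var"

definition entails :: "'x form \<Rightarrow> 'x form \<Rightarrow> bool" where
  "entails p q \<longleftrightarrow> (\<forall>v. eval v p \<longrightarrow> eval v q)"

definition entails_p :: "'a form \<Rightarrow> 'a form \<Rightarrow> bool" (infix "\<Turnstile>\<^sub>p" 50) where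
  "p \<Turnstile>\<^sub>p q \<longleftrightarrow> entails (bool_abs p) (bool_abs q)"

lemma eval_map_form: "eval v (map_form b p) = eval (v \<circ> b) p"
  by (induction p) auto

text \<open>The choice of Boolean variables is immaterial.\<close>

lemma entails_p_iff:
  assumes "inj b"
  shows "p \<Turnstile>\<^sub>p q \<longleftrightarrow> entails (map_form b p) (map_form b q)"
proof -
  have surj: "\<exists>v. w = v \<circ> c" if "inj c" for c :: "'a \<Rightarrow> 'z" and w :: "'a \<Rightarrow> bool"
    by (rule exI[of _ "w \<circ> inv c"]) (simp add: comp_assoc inv_o_cancel that)
  have *: "entails (map_form c p) (map_form c q) \<longleftrightarrow> (\<forall>w. eval w p \<longrightarrow> eval w q)"
    if "inj c" for c :: "'a \<Rightarrow> 'z"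
    unfolding entails_def eval_map_form using surj[OF that] by metis
  have surj': "\<exists>v. w = v \<circ> (Bool_Var :: 'a \<Rightarrow> _)" for w :: "'a \<Rightarrow> bool"
    by (rule exI[of _ "case_bool_var w"]) auto
  have "p \<Turnstile>\<^sub>p q \<longleftrightarrow> (\<forall>w. eval w p \<longrightarrow> eval w q)"
    unfolding entails_p_def bool_abs_def entails_def eval_map_form using surj' by metis
  with *[OF assms] show ?thesis by simp
qed

datatype ('f, 'v) trm = Var 'v | Fun 'f "('f, 'v) trm list"

datatype ('f, 'p, 'v) tatom =
    Eq "('f, 'v) trm" "('f, 'v) trm"
  | Pred 'p "('f, 'v) trm list"

datatype ('f, 'p, 'v, 'b) atom = TAtom "('f, 'p, 'v) tatom" | BAtom 'b

type_synonym ('f, 'p, 'v, 'b) tform = "('f, 'p, 'v, 'b) atom form"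

record ('f, 'p, 'u) struct =
  dom :: "'u set"
  fun_int :: "'f \<Rightarrow> 'u list \<Rightarrow> 'u"
  pred_int :: "'p \<Rightarrow> 'u list \<Rightarrow> bool"

text \<open>A symbol together with the number of its arguments plays the role of a symbol of fixed
  arity.\<close>

definition is_struct :: "('f, 'p, 'u) struct \<Rightarrow> bool" where
  "is_struct M \<longleftrightarrow> dom M \<noteq> {} \<and> (\<forall>f us. set us \<subseteq> dom M \<longrightarrow> fun_int M f us \<in> dom M)"

text \<open>A theory is given by its class of models. This covers both theories presented by axioms
  and theories presented by a fixed intended model.\<close>

definition is_theory :: "('f, 'p, 'u) struct set \<Rightarrow> bool" where
  "is_theory T \<longleftrightarrow> (\<forall>M\<in>T. is_struct M)"

primrec trm_val :: "('f, 'p, 'u) struct \<Rightarrow> ('v \<Rightarrow> 'u) \<Rightarrow> ('f, 'v) trm \<Rightarrow> 'u" where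
  "trm_val M s (Var x) = s x"
| "trm_val M s (Fun f ts) = fun_int M f (map (trm_val M s) ts)"

primrec tatom_val :: "('f, 'p, 'u) struct \<Rightarrow> ('v \<Rightarrow> 'u) \<Rightarrow> ('f, 'p, 'v) tatom \<Rightarrow> bool" where
  "tatom_val M s (Eq t u) = (trm_val M s t = trm_val M s u)"
| "tatom_val M s (Pred p ts) = pred_int M p (map (trm_val M s) ts)"

primrec atom_val ::
  "('f, 'p, 'u) struct \<Rightarrow> ('v \<Rightarrow> 'u) \<Rightarrow> ('b \<Rightarrow> bool) \<Rightarrow> ('f, 'p, 'v, 'b) atom \<Rightarrow> bool" where
  "atom_val M s \<beta> (TAtom a) = tatom_val M s a"
| "atom_val M s \<beta> (BAtom b) = \<beta> b"

text \<open>Variables of quantifier-free formulas are read as free constants, hence the quantification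
  over the assignment \<open>s\<close> next to that over the model.\<close>

definition T_satisfiable :: "('f, 'p, 'u) struct set \<Rightarrow> ('f, 'p, 'v, 'b) tform \<Rightarrow> bool" where
  "T_satisfiable T \<phi> \<longleftrightarrow>
    (\<exists>M\<in>T. \<exists>s \<beta>. range s \<subseteq> dom M \<and> eval (atom_val M s \<beta>) \<phi>)"

definition T_valid :: "('f, 'p, 'u) struct set \<Rightarrow> ('f, 'p, 'v, 'b) tform \<Rightarrow> bool" where
  "T_valid T \<phi> \<longleftrightarrow>
    (\<forall>M\<in>T. \<forall>s \<beta>. range s \<subseteq> dom M \<longrightarrow> eval (atom_val M s \<beta>) \<phi>)"

definition T_equiv ::
  "('f, 'p, 'u) struct set \<Rightarrow> ('f, 'p, 'v, 'b) tform \<Rightarrow> ('f, 'p, 'v, 'b) tform \<Rightarrow> bool" where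
  "T_equiv T \<phi> \<psi> \<longleftrightarrow>
    (\<forall>M\<in>T. \<forall>s \<beta>. range s \<subseteq> dom M \<longrightarrow>
       (eval (atom_val M s \<beta>) \<phi> \<longleftrightarrow> eval (atom_val M s \<beta>) \<psi>))"

definition T_lemma :: "('f, 'p, 'u) struct set \<Rightarrow> ('f, 'p, 'v, 'b) tform \<Rightarrow> bool" where
  "T_lemma T C \<longleftrightarrow> is_clause C \<and> T_valid T C"

definition unsat_assignments ::
  "('f, 'p, 'u) struct set \<Rightarrow> ('f, 'p, 'v, 'b) atom set \<Rightarrow> ('f, 'p, 'v, 'b) tform
     \<Rightarrow> ('f, 'p, 'v, 'b) tform set" where
  "unsat_assignments T \<alpha> \<psi> =
    {\<rho>. total_assignment \<alpha> \<rho> \<and> \<not> T_satisfiable T \<rho> \<and> \<rho> \<Turnstile>\<^sub>p \<psi>}"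

definition rules_out :: "'a form set \<Rightarrow> 'a form set \<Rightarrow> bool" where
  "rules_out \<C> R \<longleftrightarrow> (\<forall>\<rho>\<in>R. \<exists>C\<in>\<C>. \<rho> \<Turnstile>\<^sub>p Neg C)"

definition T_extended ::
  "('f, 'p, 'u) struct set \<Rightarrow> ('f, 'p, 'v, 'b) atom set \<Rightarrow> ('f, 'p, 'v, 'b) tform \<Rightarrow> bool" where
  "T_extended T \<alpha> \<psi> \<longleftrightarrow> unsat_assignments T \<alpha> (Neg \<psi>) = {}"

definition Text :: "'a form \<Rightarrow> 'a form list \<Rightarrow> 'a form" where
  "Text \<phi> Cs = Or \<phi> (Neg (big_and Cs))"

end

theory Submission
  imports Defs
begin

text \<open>The \<open>Cs\<close> hold in every model of \<open>T\<close>, so the added disjunct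
  \<open>Neg (big_and Cs)\<close> is false there: this gives (i), and (ii) is weakening to a
  disjunction. For (iii), an unsatisfiable total assignment entailing
  \<open>Neg (Text \<phi> Cs)\<close> would entail \<open>Neg \<phi>\<close>, hence be ruled out by
  some \<open>C\<close>, yet it would also entail \<open>C\<close>. This is absurd because total
  assignments are propositionally satisfiable.\<close>

lemma eval_big_and: "eval v (big_and ps) \<longleftrightarrow> (\<forall>p\<in>set ps. eval v p)"
  by (induction ps rule: big_and.induct) auto

text \<open>Atoms can serve as their own Boolean variables, since \<open>id\<close> is
  injective.\<close>

lemma entails_p_iff_eval: "p \<Turnstile>\<^sub>p q \<longleftrightarrow> (\<forall>v. eval v p \<longrightarrow> eval v q)"
  using entails_p_iff[of id p q] by (simp add: entails_def form.map_id)

text \<open>Needed because an inconsistent \<rho> would entail both \<open>C\<close> and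
  \<open>Neg C\<close>.\<close>

lemma total_assignment_propositionally_satisfiable:
  assumes "total_assignment \<alpha> \<rho>"
  obtains v where "eval v \<rho>"
proof -
  from assms obtain ls where
    lits: "\<forall>l\<in>set ls. \<exists>a\<in>\<alpha>. l = Atom a \<or> l = Neg (Atom a)" and
    excl: "\<forall>a\<in>\<alpha>. (Atom a \<in> set ls) \<noteq> (Neg (Atom a) \<in> set ls)" and
    \<rho>: "\<rho> = big_and ls"
    unfolding total_assignment_def by blast
  \<comment> \<open>Make true exactly the atoms listed positively; by \<open>excl\<close>, a listed
    \<open>Neg (Atom a)\<close> then holds too.\<close>
  have "eval (\<lambda>a. Atom a \<in> set ls) l" if "l \<in> set ls" for l
    using that lits excl by fastforce
  then show thesis
    by (intro that[of "\<lambda>a. Atom a \<in> set ls"]) (simp add: \<rho> eval_big_and)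
qed

lemma T_equiv_Text:
  assumes "\<forall>C\<in>set Cs. T_valid T C"
  shows "T_equiv T (Text \<phi> Cs) \<phi>"
  using assms by (auto simp: T_equiv_def Text_def T_valid_def eval_big_and)

lemma entails_p_Text: "\<phi> \<Turnstile>\<^sub>p Text \<phi> Cs"
  by (simp add: entails_p_iff_eval Text_def)

lemma T_extended_Text:
  assumes "rules_out (set Cs) (unsat_assignments T \<alpha> (Neg \<phi>))"
  shows "T_extended T \<alpha> (Text \<phi> Cs)"
  unfolding T_extended_def
proof (rule equals0I)
  fix \<rho> assume "\<rho> \<in> unsat_assignments T \<alpha> (Neg (Text \<phi> Cs))"
  then have \<rho>: "total_assignment \<alpha> \<rho>" "\<not> T_satisfiable T \<rho>" "\<rho> \<Turnstile>\<^sub>p Neg (Text \<phi> Cs)"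
    by (simp_all add: unsat_assignments_def)
  \<comment> \<open>\<open>Neg (Text \<phi> Cs)\<close> amounts to \<open>Neg \<phi>\<close>
    together with all of \<open>Cs\<close>; the first part is used here, the second against
    \<open>C\<close> at the end.\<close>
  then have "\<rho> \<in> unsat_assignments T \<alpha> (Neg \<phi>)"
    by (simp add: unsat_assignments_def entails_p_iff_eval Text_def)
  with assms obtain C where C: "C \<in> set Cs" "\<rho> \<Turnstile>\<^sub>p Neg C"
    unfolding rules_out_def by blast
  obtain v where "eval v \<rho>"
    using \<rho>(1) by (rule total_assignment_propositionally_satisfiable)
  with \<rho>(3) C show False
    by (auto simp: entails_p_iff_eval Text_def eval_big_and)
qed

theorem theorem4p12:
  fixes T :: "('f, 'p, 'u) struct set"
    and \<phi> :: "('f, 'p, 'v, 'b) tform"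
    and \<alpha> :: "('f, 'p, 'v, 'b) atom set"
    and Cs :: "('f, 'p, 'v, 'b) tform list"
  assumes "is_theory T"
    and "finite \<alpha>"
    and "atoms \<phi> \<subseteq> \<alpha>"
    and "\<forall>C\<in>set Cs. T_lemma T C \<and> atoms C \<subseteq> \<alpha>"
    and "rules_out (set Cs) (unsat_assignments T \<alpha> (Neg \<phi>))"
  shows "T_equiv T (Text \<phi> Cs) \<phi> \<and> \<phi> \<Turnstile>\<^sub>p Text \<phi> Cs \<and> T_extended T \<alpha> (Text \<phi> Cs)"
  using assms by (simp add: T_lemma_def T_equiv_Text entails_p_Text T_extended_Text)

end
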